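(* Let $p$ be an odd prime and $q\in\mathbb{C}_p$ with $|1-q|_p<p^{-1/(p-1)}$. Let $m\in\mathbb{Z}_+=\{0,1,2,\dots\}$ and $\alpha,n\in\mathbb{N}$. Then $$q^n\widetilde{\beta}_{m,q}^{(\alpha)}(n)-\widetilde{\beta}_{m,q}^{(\alpha)}=(q-1)\sum_{l=0}^{n-1}q^l[l]_{q^\alpha}^m+\frac{m\alpha}{[\alpha]_q}\sum_{l=0}^{n-1}q^{\alpha l+l}[l]_{q^\alpha}^{m-1},$$ where the second sum is taken to be $0$ when $m=0$.
   Context: $q^x=\exp(x\log q)$ for $x\in\mathbb{Z}_p$; $[x]_q=\frac{1-q^x}{1-q}$, so $[x]_{q^\alpha}=\frac{1-q^{\alpha x}}{1-q^\alpha}$ and $[\alpha]_q=\frac{1-q^\alpha}{1-q}$. For uniformly differentiable $f:\mathbb{Z}_p\to\mathbb{C}_p$, $\int_{\mathbb{Z}_p}f(y)\,d\mu_q(y)=\lim_{N\to\infty}\frac{1}{[p^N]_q}\sum_{y=0}^{p^N-1}f(y)q^y$. Define $\widetilde{\beta}_{m,q}^{(\alpha)}(x)=\int_{\mathbb{Z}_p}[x+y]_{q^\alpha}^m\,d\mu_q(y)$ for $x\in\mathbb{Z}_p$, and $\widetilde{\beta}_{m,q}^{(\alpha)}=\widetilde{\beta}_{m,q}^{(\alpha)}(0)$. *)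

theory Defs
  imports "HOL-Analysis.Analysis" "HOL-Computational_Algebra.Computational_Algebra"
begin

text \<open>The library's \<open>norm\<close> is tied to real vector spaces, hence a separate absolute value.\<close>

class nonarch_field = field_char_0 + complete_space +
  fixes vabs :: "'a \<Rightarrow> real"
  assumes dist_vabs: "dist x y = vabs (x - y)"
    and vabs_mult: "vabs (x * y) = vabs x * vabs y"
    and vabs_add: "vabs (x + y) \<le> max (vabs x) (vabs y)"

text \<open>
  \<open>\<complex>\<^sub>p\<close> is the completion of an algebraic closure of \<open>\<rat>\<^sub>p\<close>, where \<open>\<rat>\<^sub>p\<close> is the completion of
  \<open>\<rat>\<close> for the \<open>p\<close>-adic absolute value. Since \<open>p\<close> is a term, \<open>\<complex>\<^sub>p\<close> is not a fixed type; it is an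
  arbitrary complete valued field satisfying this description, which determines it up to
  isometric isomorphism. In a complete field the completion of a subset is its closure.
\<close>

definition Qp :: "'a::nonarch_field set"
  where "Qp = closure \<rat>"

definition Qp_bar :: "'a::nonarch_field set"
  where "Qp_bar = {x. \<exists>f. f \<noteq> 0 \<and> (\<forall>i. coeff f i \<in> Qp) \<and> poly f x = 0}"

definition is_Cp :: "nat \<Rightarrow> 'a::nonarch_field itself \<Rightarrow> bool"
  where "is_Cp p _ \<longleftrightarrow>
    (\<forall>k::int. k \<noteq> 0 \<longrightarrow> vabs (of_int k :: 'a) = (1 / real p) ^ multiplicity (int p) k) \<and>
    (\<forall>f :: 'a poly. (\<forall>i. coeff f i \<in> Qp_bar) \<and> degree f > 0 \<longrightarrow> (\<exists>x\<in>Qp_bar. poly f x = 0)) \<and>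
    closure (Qp_bar :: 'a set) = UNIV"

definition padic_exp :: "'a::nonarch_field \<Rightarrow> 'a"
  where "padic_exp x = (\<Sum>k. x ^ k / fact k)"

definition padic_log :: "'a::nonarch_field \<Rightarrow> 'a"
  where "padic_log x = (\<Sum>k. (-1) ^ k * (x - 1) ^ Suc k / of_nat (Suc k))"

definition qpow :: "'a::nonarch_field \<Rightarrow> 'a \<Rightarrow> 'a"
  where "qpow q x = padic_exp (x * padic_log q)"

text \<open>At \<open>q = 1\<close> the quotient is \<open>0/0\<close>; the bracket then has its limiting value \<open>x\<close>.\<close>

definition qbracket :: "'a::nonarch_field \<Rightarrow> 'a \<Rightarrow> 'a"
  where "qbracket q x = (if q = 1 then x else (1 - qpow q x) / (1 - q))"

text \<open>The integral over \<open>\<int>\<^sub>p\<close> only evaluates \<open>f\<close> at natural numbers; it is meaningful when the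
  limit exists, in particular for uniformly differentiable \<open>f\<close>.\<close>

definition volkenborn_q :: "nat \<Rightarrow> 'a::nonarch_field \<Rightarrow> ('a \<Rightarrow> 'a) \<Rightarrow> 'a"
  where "volkenborn_q p q f =
    lim (\<lambda>N. 1 / qbracket q (of_nat (p ^ N)) * (\<Sum>y<p ^ N. f (of_nat y) * q ^ y))"

definition q_bernoulli_poly :: "nat \<Rightarrow> nat \<Rightarrow> nat \<Rightarrow> 'a::nonarch_field \<Rightarrow> 'a \<Rightarrow> 'a"
  where "q_bernoulli_poly p \<alpha> m q x = volkenborn_q p q (\<lambda>y. qbracket (q ^ \<alpha>) (x + y) ^ m)"

definition q_bernoulli_number :: "nat \<Rightarrow> nat \<Rightarrow> nat \<Rightarrow> 'a::nonarch_field \<Rightarrow> 'a"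
  where "q_bernoulli_number p \<alpha> m q = q_bernoulli_poly p \<alpha> m q 0"

end

theory Submission
  imports Defs
begin

text \<open>
  Write \<open>f y = [y]\<^sup>m\<close> in base \<open>q\<^bsup>\<alpha>\<^esup>\<close>. Multiplying the \<open>N\<close>-th approximating sum at \<open>n\<close> by \<open>q\<^sup>n\<close>
  shifts its range of summation by \<open>n\<close>, so it differs from the sum at \<open>0\<close> only by the boundary
  terms \<open>(f (l + p\<^sup>N) q\<^bsup>l + p^N\<^esup> - f l q\<^sup>l) / [p\<^sup>N]\<^sub>q\<close> with \<open>l < n\<close>. Since \<open>q\<^bsup>p^N\<^esup> \<longlonglongrightarrow> 1\<close>, these converge to
  difference quotients that give the right-hand side. The shift by one also yields a recursion in
  \<open>m\<close> which shows that the integrals exist. The \<open>p\<close>-adic input is \<open>exp (k log q) = q\<^sup>k\<close> for natural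
  \<open>k\<close> and \<open>\<bar>q\<^sup>k - 1\<bar> = \<bar>k\<bar> \<bar>q - 1\<bar>\<close>, both valid on the disc of convergence of \<open>exp\<close>.
\<close>

section \<open>Non-archimedean absolute values\<close>

lemma vabs_nonneg [simp]: "0 \<le> vabs (x :: 'a::nonarch_field)"
  using zero_le_dist[of x 0] by (simp add: dist_vabs)

lemma vabs_eq_0_iff [simp]: "vabs (x :: 'a::nonarch_field) = 0 \<longleftrightarrow> x = 0"
  using dist_eq_0_iff[of x 0] by (simp add: dist_vabs)

lemma vabs_0 [simp]: "vabs (0 :: 'a::nonarch_field) = 0"
  by simp

lemma vabs_le_0_iff [simp]: "vabs (x :: 'a::nonarch_field) \<le> 0 \<longleftrightarrow> x = 0"
  by (simp add: antisym_conv)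

lemma vabs_pos_iff [simp]: "0 < vabs (x :: 'a::nonarch_field) \<longleftrightarrow> x \<noteq> 0"
  by (simp flip: not_le)

lemma vabs_1 [simp]: "vabs (1 :: 'a::nonarch_field) = 1"
  using vabs_mult[of "1 :: 'a" 1] by (auto simp del: vabs_eq_0_iff simp: vabs_eq_0_iff[of "1::'a"])

lemma vabs_minus_commute: "vabs (x - y) = vabs (y - x :: 'a::nonarch_field)"
  using dist_commute[of x y] by (simp add: dist_vabs)

lemma vabs_minus [simp]: "vabs (- x) = vabs (x :: 'a::nonarch_field)"
  using vabs_minus_commute[of 0 x] by simp

lemma vabs_diff: "vabs (x - y) \<le> max (vabs x) (vabs (y :: 'a::nonarch_field))"
  using vabs_add[of x "- y"] by simp

lemma vabs_power: "vabs (x ^ n) = vabs (x :: 'a::nonarch_field) ^ n"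
  by (induction n) (auto simp: vabs_mult)

lemma vabs_divide: "vabs (x / y) = vabs x / vabs (y :: 'a::nonarch_field)"
proof (cases "y = 0")
  case False
  then have "vabs (x / y) * vabs y = vabs x"
    by (simp flip: vabs_mult)
  with False show ?thesis by (simp add: field_simps)
qed simp

lemma vabs_sum_le:
  fixes f :: "'b \<Rightarrow> 'a::nonarch_field"
  assumes "\<And>i. i \<in> A \<Longrightarrow> vabs (f i) \<le> B" "0 \<le> B"
  shows "vabs (sum f A) \<le> B"
  using assms(1)
proof (induction A rule: infinite_finite_induct)
  case (insert x F)
  then show ?case using vabs_add[of "f x" "sum f F"] by fastforce
qed (use assms(2) in auto)

lemma vabs_of_nat_le_1: "vabs (of_nat n :: 'a::nonarch_field) \<le> 1"
proof (induction n)
  case (Suc n)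
  then show ?case using vabs_add[of 1 "of_nat n :: 'a"] by auto
qed simp

text \<open>In an isosceles triangle for an ultrametric the two longest sides are equal.\<close>

lemma vabs_add_eq:
  fixes x y :: "'a::nonarch_field"
  assumes "vabs y < vabs x"
  shows "vabs (x + y) = vabs x"
  using vabs_add[of x y] vabs_diff[of "x + y" y] assms by (simp add: max_def split: if_splits)

section \<open>Convergence measured by \<open>vabs\<close>, and continuity of the field
  operations\<close>

lemma tendsto_vabs_iff:
  fixes f :: "'b \<Rightarrow> 'a::nonarch_field"
  shows "(f \<longlongrightarrow> L) F \<longleftrightarrow> ((\<lambda>x. vabs (f x - L)) \<longlongrightarrow> 0) F"
  by (subst tendsto_dist_iff) (simp add: dist_vabs)

lemma vabs_null_comparison:
  fixes f :: "'b \<Rightarrow> 'a::nonarch_field"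
  assumes "(g \<longlongrightarrow> 0) F" "\<And>x. vabs (f x - L) \<le> g x"
  shows "(f \<longlongrightarrow> L) F"
  unfolding tendsto_vabs_iff
  by (rule tendsto_sandwich[OF _ _ tendsto_const assms(1)]) (use assms(2) in auto)

lemma eventually_vabs_less:
  fixes f :: "'b \<Rightarrow> 'a::nonarch_field"
  assumes "(f \<longlongrightarrow> 0) F" "e > 0"
  shows "\<forall>\<^sub>F x in F. vabs (f x) < e"
  using tendstoD[OF assms] by (simp add: dist_vabs)

text \<open>Makes the general limit rules for sums and differences applicable to the metric given by
  \<open>vabs\<close>; the next instance does the same for products.\<close>

instance nonarch_field \<subseteq> topological_ab_group_add
proof
  fix a b :: 'a
  let ?F = "nhds a \<times>\<^sub>F nhds b"
  show "((\<lambda>x. fst x + snd x) \<longlongrightarrow> a + b) ?F"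
  proof (rule vabs_null_comparison)
    have "((\<lambda>x. vabs (fst x - a)) \<longlongrightarrow> 0) ?F"
      by (subst tendsto_vabs_iff[symmetric], rule filterlim_fst)
    moreover have "((\<lambda>x. vabs (snd x - b)) \<longlongrightarrow> 0) ?F"
      by (subst tendsto_vabs_iff[symmetric], rule filterlim_snd)
    ultimately show "((\<lambda>x. max (vabs (fst x - a)) (vabs (snd x - b))) \<longlongrightarrow> 0) ?F"
      using tendsto_max by fastforce
    show "vabs (fst x + snd x - (a + b)) \<le> max (vabs (fst x - a)) (vabs (snd x - b))" for x
      using vabs_add[of "fst x - a" "snd x - b"] by (simp add: algebra_simps)
  qed
next
  fix a :: 'a
  show "(uminus \<longlongrightarrow> - a) (nhds a)"
  proof (rule vabs_null_comparison)
    show "((\<lambda>x. vabs (x - a)) \<longlongrightarrow> 0) (nhds a)"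
      by (subst tendsto_vabs_iff[symmetric], rule filterlim_ident)
    show "vabs (- x - - a) \<le> vabs (x - a)" for x
      using vabs_minus_commute[of x a] by simp
  qed
qed

instance nonarch_field \<subseteq> topological_comm_monoid_mult
proof
  fix a b :: 'a
  let ?F = "nhds a \<times>\<^sub>F nhds b"
  show "((\<lambda>x. fst x * snd x) \<longlongrightarrow> a * b) ?F"
  proof (rule vabs_null_comparison)
    have A: "((\<lambda>x. vabs (fst x - a)) \<longlongrightarrow> 0) ?F"
      by (subst tendsto_vabs_iff[symmetric], rule filterlim_fst)
    have B: "((\<lambda>x. vabs (snd x - b)) \<longlongrightarrow> 0) ?F"
      by (subst tendsto_vabs_iff[symmetric], rule filterlim_snd)
    show "((\<lambda>x. vabs (fst x - a) * vabs (snd x - b) + vabs (fst x - a) * vabs b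
        + vabs a * vabs (snd x - b)) \<longlongrightarrow> 0) ?F"
      by (rule tendsto_eq_intros A B refl | simp)+
    show "vabs (fst x * snd x - a * b) \<le> vabs (fst x - a) * vabs (snd x - b)
        + vabs (fst x - a) * vabs b + vabs a * vabs (snd x - b)" for x
    proof -
      have *: "vabs (u + v) \<le> vabs u + vabs v" for u v :: 'a
        using vabs_add[of u v] vabs_nonneg[of u] vabs_nonneg[of v] by linarith
      have "fst x * snd x - a * b = (fst x - a) * (snd x - b) + (fst x - a) * b + a * (snd x - b)"
        by (simp add: algebra_simps)
      then show ?thesis
        using *[of "(fst x - a) * (snd x - b) + (fst x - a) * b" "a * (snd x - b)"]
          *[of "(fst x - a) * (snd x - b)" "(fst x - a) * b"] by (simp add: vabs_mult)
    qed
  qed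
qed

section \<open>Series under the strong triangle inequality\<close>

lemma LIMSEQ_vabs_le:
  fixes X :: "nat \<Rightarrow> 'a::nonarch_field"
  assumes "X \<longlonglongrightarrow> L" "\<And>n. vabs (X n) \<le> B"
  shows "vabs L \<le> B"
proof -
  have "(\<lambda>n. dist (X n) 0) \<longlonglongrightarrow> dist L 0"
    by (intro tendsto_dist assms tendsto_const)
  then show ?thesis
    using assms(2) by (intro Lim_bounded[of _ "vabs L" 0 B]) (auto simp: dist_vabs)
qed

lemma sums_diff_nonarch:
  fixes f g :: "nat \<Rightarrow> 'a::nonarch_field"
  assumes "f sums a" "g sums b"
  shows "(\<lambda>n. f n - g n) sums (a - b)"
  using tendsto_diff[OF assms[unfolded sums_def]] by (simp add: sums_def sum_subtractf)

text \<open>A block of consecutive terms is no larger than its largest term, so null terms already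
  make the partial sums Cauchy.\<close>

lemma summable_nonarch:
  fixes f :: "nat \<Rightarrow> 'a::nonarch_field"
  assumes "f \<longlonglongrightarrow> 0"
  shows "summable f"
proof -
  have "Cauchy (\<lambda>n. \<Sum>i<n. f i)"
  proof (rule metric_CauchyI)
    fix e :: real assume "e > 0"
    then have "\<forall>\<^sub>F n in sequentially. vabs (f n) < e / 2"
      using assms by (intro eventually_vabs_less) auto
    then obtain M where M: "\<And>n. n \<ge> M \<Longrightarrow> vabs (f n) < e / 2"
      by (auto simp: eventually_sequentially)
    have *: "vabs ((\<Sum>i<n. f i) - (\<Sum>i<m. f i)) < e" if "m \<ge> M" "m \<le> n" for m n
    proof -
      have "(\<Sum>i<n. f i) - (\<Sum>i<m. f i) = (\<Sum>i=m..<n. f i)"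
        using that by (simp add: sum_diff_nat_ivl lessThan_atLeast0)
      moreover have "vabs \<dots> \<le> e / 2"
        using M that \<open>e > 0\<close> by (intro vabs_sum_le) (auto intro!: less_imp_le)
      ultimately show ?thesis using \<open>e > 0\<close> by simp
    qed
    have "dist (\<Sum>i<m. f i) (\<Sum>i<n. f i) < e" if "m \<ge> M" "n \<ge> M" for m n
      using *[of m n] *[of n m] that vabs_minus_commute[of "\<Sum>i<m. f i"]
      by (cases "m \<le> n") (auto simp: dist_vabs)
    then show "\<exists>M. \<forall>m\<ge>M. \<forall>n\<ge>M. dist (\<Sum>i<m. f i) (\<Sum>i<n. f i) < e"
      by blast
  qed
  then show ?thesis
    by (simp add: summable_iff_convergent Cauchy_convergent_iff)
qed

lemma vabs_suminf_le:
  fixes f :: "nat \<Rightarrow> 'a::nonarch_field"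
  assumes "summable f" "\<And>k. vabs (f k) \<le> B"
  shows "vabs (suminf f) \<le> B"
proof -
  have "0 \<le> B" using assms(2)[of 0] vabs_nonneg order_trans by blast
  then show ?thesis
    by (intro LIMSEQ_vabs_le[OF summable_LIMSEQ[OF assms(1)]] vabs_sum_le assms(2))
qed

text \<open>Dominated convergence: the majorant controls all terms from some \<open>K\<close> on,
  uniformly in \<open>N\<close>, and the finitely many others are small for large \<open>N\<close>.
  The sum is bounded by the maximum of the two bounds.\<close>

lemma suminf_nonarch_dominated:
  fixes a :: "nat \<Rightarrow> nat \<Rightarrow> 'a::nonarch_field"
  assumes "\<And>N k. vabs (a N k) \<le> b k" "b \<longlonglongrightarrow> 0" "\<And>k. (\<lambda>N. a N k) \<longlonglongrightarrow> 0"
  shows "(\<lambda>N. suminf (a N)) \<longlonglongrightarrow> 0"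
proof (rule metric_LIMSEQ_I)
  fix e :: real assume e: "e > 0"
  have "a N \<longlonglongrightarrow> 0" for N
    by (rule vabs_null_comparison[OF assms(2)]) (simp add: assms(1))
  then have sm: "summable (a N)" for N by (rule summable_nonarch)
  have "\<forall>\<^sub>F k in sequentially. b k < e / 2"
    using e by (intro order_tendstoD(2)[OF assms(2)]) simp
  then obtain K where K: "\<And>k. k \<ge> K \<Longrightarrow> b k < e / 2"
    by (auto simp: eventually_sequentially)
  have "\<forall>\<^sub>F N in sequentially. \<forall>k\<in>{..<K}. vabs (a N k) < e / 2"
    using assms(3) e by (intro eventually_ball_finite ballI eventually_vabs_less) auto
  then obtain M where M: "\<And>N k. N \<ge> M \<Longrightarrow> k < K \<Longrightarrow> vabs (a N k) < e / 2"
    by (auto simp: eventually_sequentially)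
  have "vabs (suminf (a N)) \<le> e / 2" if "N \<ge> M" for N
  proof (rule vabs_suminf_le[OF sm])
    fix k
    show "vabs (a N k) \<le> e / 2"
      using M[OF that, of k] K[of k] assms(1)[of N k] by (cases "k < K") auto
  qed
  then show "\<exists>M. \<forall>N\<ge>M. dist (suminf (a N)) 0 < e"
    using e by (intro exI[of _ M]) (fastforce simp: dist_vabs)
qed

section \<open>The \<open>p\<close>-adic exponential and logarithm\<close>

locale padic_valued =
  fixes p :: nat and T :: "'a::nonarch_field itself"
  assumes prime: "prime p"
    and vabs_of_int: "k \<noteq> 0 \<Longrightarrow> vabs (of_int k :: 'a) = (1 / real p) ^ multiplicity (int p) k"
begin

text \<open>The radius of convergence of the p-adic exponential series.\<close>

definition radius :: real
  where "radius = real p powr (- 1 / (real p - 1))"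

lemma p_gt_1: "p > 1"
  using prime prime_gt_1_nat by blast

lemma radius_pos: "0 < radius"
  using p_gt_1 by (simp add: radius_def)

lemma radius_less_1: "radius < 1"
  unfolding radius_def using p_gt_1 by (intro powr_less_one) auto

lemma radius_power: "radius ^ (p - 1) = 1 / real p"
proof -
  have "radius ^ (p - 1) = radius powr real (p - 1)"
    using radius_pos by (simp add: powr_realpow)
  also have "\<dots> = real p powr (- 1)"
    using p_gt_1 by (simp add: radius_def powr_powr of_nat_diff)
  finally show ?thesis using p_gt_1 by (simp add: powr_minus_divide)
qed

lemma vabs_p: "vabs (of_nat p :: 'a) = 1 / real p"
proof -
  have "multiplicity (int p) (int p) = 1"
    using prime prime_gt_1_nat[of p] by (intro multiplicity_self) (auto simp: prime_elem_iff_prime_abs)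
  then show ?thesis using vabs_of_int[of "int p"] p_gt_1 by simp
qed

section \<open>Absolute values of factorials\<close>

lemma vabs_coprime:
  assumes "\<not> p dvd k"
  shows "vabs (of_nat k :: 'a) = 1"
proof -
  have "k \<noteq> 0" using assms by (cases k) auto
  have "multiplicity (int p) (int k) = 0"
    using assms by (intro not_dvd_imp_multiplicity_0) simp
  then show ?thesis using vabs_of_int[of "int k"] \<open>k \<noteq> 0\<close> by simp
qed

text \<open>The additional factors \<open>p * m + 1, ..., p * m + j\<close> are prime to
  \<open>p\<close>, hence units.\<close>

lemma vabs_fact_block:
  assumes "j < p"
  shows "vabs (fact (p * m + j) :: 'a) = vabs (fact (p * m) :: 'a)"
  using assms
proof (induction j)
  case (Suc j)
  have "\<not> p dvd Suc (p * m + j)"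
    using Suc.prems by (metis add_Suc_right dvd_add_right_iff dvd_triv_left nat_dvd_not_less zero_less_Suc)
  then show ?case
    using Suc vabs_coprime[of "Suc (p * m + j)"]
    by (simp add: vabs_mult del: of_nat_Suc)
qed simp

text \<open>Among the factors of \<open>(p * m)!\<close> only the multiples \<open>p * i\<close>
  with \<open>1 \<le> i \<le> m\<close> are not units.\<close>

lemma vabs_fact_mult:
  "vabs (fact (p * m) :: 'a) = (1 / real p) ^ m * vabs (fact m :: 'a)"
proof (induction m)
  case (Suc m)
  have "p * Suc m = Suc (p * m + (p - 1))" using p_gt_1 by simp
  then have "(fact (p * Suc m) :: 'a) = of_nat (p * Suc m) * fact (p * m + (p - 1))"
    by (metis fact_Suc of_nat_mult)
  then have "vabs (fact (p * Suc m) :: 'a) = vabs (of_nat p :: 'a) * vabs (of_nat (Suc m) :: 'a)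
      * vabs (fact (p * m + (p - 1)) :: 'a)"
    by (simp only: vabs_mult of_nat_mult)
  also have "vabs (fact (p * m + (p - 1)) :: 'a) = (1 / real p) ^ m * vabs (fact m :: 'a)"
    using p_gt_1 by (subst vabs_fact_block) (simp_all add: Suc)
  also have "vabs (of_nat p :: 'a) * vabs (of_nat (Suc m) :: 'a) * \<dots>
      = (1 / real p) ^ Suc m * vabs (fact (Suc m) :: 'a)"
    by (simp add: vabs_p vabs_mult del: of_nat_Suc)
  finally show ?case .
qed simp

text \<open>Legendre's bound \<open>v\<^sub>p (n!) \<le> (n - 1) / (p - 1)\<close>.\<close>

lemma vabs_fact_ge: "radius ^ (n - 1) \<le> vabs (fact n :: 'a)"
proof (induction n rule: less_induct)
  case (less n)
  define m j where "m = n div p" and "j = n mod p"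
  have n: "n = p * m + j" and j: "j < p"
    using p_gt_1 by (auto simp: m_def j_def)
  have *: "vabs (fact n :: 'a) = (1 / real p) ^ m * vabs (fact m :: 'a)"
    unfolding n vabs_fact_block[OF j] vabs_fact_mult ..
  show ?case
  proof (cases "m = 0")
    case True
    then show ?thesis using * radius_pos radius_less_1 by (simp add: power_le_one)
  next
    case False
    have "m * 2 \<le> p * m" using p_gt_1 by simp
    then have "m < n" using False n by linarith
    \<comment> \<open>Each factor \<open>1 / p\<close> equals \<open>radius ^ (p - 1)\<close>, so
      this is the total exponent of \<open>m\<close> such factors and the bound for
      \<open>m!\<close>.\<close>
    have "(p - 1) * m + (m - 1) = p * m - 1"
      using False p_gt_1 by (cases p) auto
    then have "radius ^ (p * m - 1) = (1 / real p) ^ m * radius ^ (m - 1)"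
      by (metis power_add power_mult radius_power)
    also have "\<dots> \<le> vabs (fact n :: 'a)"
      unfolding * using less[OF \<open>m < n\<close>] by (intro mult_left_mono) auto
    finally have "radius ^ (p * m - 1) \<le> vabs (fact n :: 'a)" .
    moreover have "radius ^ (n - 1) \<le> radius ^ (p * m - 1)"
      using radius_pos radius_less_1 n by (intro power_decreasing) auto
    ultimately show ?thesis by linarith
  qed
qed

section \<open>The exponential series\<close>

lemma vabs_exp_term_le:
  fixes x :: 'a
  shows "vabs (x ^ Suc n / fact (Suc n)) \<le> vabs x * (vabs x / radius) ^ n"
proof -
  have "vabs (x ^ Suc n / fact (Suc n)) = vabs x ^ Suc n / vabs (fact (Suc n) :: 'a)"
    by (simp only: vabs_divide vabs_power)
  also have "\<dots> \<le> vabs x ^ Suc n / radius ^ n"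
  proof (intro divide_left_mono mult_pos_pos)
    \<comment> \<open>The exponent is \<open>n\<close>, one less than the power of \<open>x\<close>;
      this leaves one factor \<open>vabs x\<close> outside the geometric ratio.\<close>
    show "radius ^ n \<le> vabs (fact (Suc n) :: 'a)" using vabs_fact_ge[of "Suc n"] by simp
    then show "0 < vabs (fact (Suc n) :: 'a)"
      using less_le_trans zero_less_power[OF radius_pos] by blast
  qed (simp_all add: radius_pos)
  finally show ?thesis by (simp add: power_divide)
qed

lemma geometric_majorant_tendsto_0:
  fixes t :: 'a
  assumes "vabs t < radius"
  shows "(\<lambda>k. vabs t * (vabs t / radius) ^ k) \<longlonglongrightarrow> 0"
proof -
  have "(\<lambda>n. vabs t * (vabs t / radius) ^ n) \<longlonglongrightarrow> vabs t * 0"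
    using assms radius_pos by (intro tendsto_mult tendsto_const LIMSEQ_power_zero) simp
  then show ?thesis by simp
qed

lemma exp_term_tendsto_0:
  fixes x :: 'a
  assumes "vabs x < radius"
  shows "(\<lambda>n. x ^ n / fact n) \<longlonglongrightarrow> 0"
proof -
  have "(\<lambda>n. x ^ Suc n / fact (Suc n)) \<longlonglongrightarrow> 0"
    using vabs_exp_term_le[of x]
    by (intro vabs_null_comparison[OF geometric_majorant_tendsto_0[OF assms]])
      (simp del: power_Suc fact_Suc)
  then show ?thesis
    by (rule LIMSEQ_imp_Suc)
qed

lemma vabs_exp_term_le_vabs:
  fixes x :: 'a
  assumes "vabs x < radius" "n > 0"
  shows "vabs (x ^ n / fact n) \<le> vabs x"
proof -
  obtain k where k: "n = Suc k" using assms(2) gr0_conv_Suc by blast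
  have "vabs x * (vabs x / radius) ^ k \<le> vabs x * 1"
    using assms radius_pos by (intro mult_left_mono power_le_one) auto
  then show ?thesis using vabs_exp_term_le[of x k] unfolding k by linarith
qed

lemma summable_padic_exp:
  fixes x :: 'a
  assumes "vabs x < radius"
  shows "summable (\<lambda>n. x ^ n / fact n)"
  by (rule summable_nonarch[OF exp_term_tendsto_0[OF assms]])

lemma padic_exp_sums:
  fixes x :: 'a
  assumes "vabs x < radius"
  shows "(\<lambda>n. x ^ n / fact n) sums padic_exp x"
  unfolding padic_exp_def using summable_padic_exp[OF assms] by (rule summable_sums)

text \<open>The product of two partial sums runs over a square of indices, the partial sum at
  \<open>x + y\<close> over the triangle \<open>i + j < n\<close>. The terms in between have large
  \<open>i + j\<close> and are uniformly small.\<close>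

lemma padic_exp_add:
  fixes x y :: 'a
  assumes x: "vabs x < radius" and y: "vabs y < radius"
  shows "padic_exp (x + y) = padic_exp x * padic_exp y"
proof -
  define S where "S z n = (\<Sum>i<n. z ^ i / fact i)" for z :: 'a and n
  \<comment> \<open>\<open>z\<close> is whichever of \<open>x\<close> and \<open>y\<close> has the
    larger absolute value; its exponential terms dominate all mixed terms, since binomial
    coefficients have absolute value at most 1.\<close>
  obtain z :: 'a where z: "vabs x \<le> vabs z" "vabs y \<le> vabs z" "vabs z < radius"
    using x y by (meson linear order_refl)
  have S: "S w \<longlonglongrightarrow> padic_exp w" if "vabs w < radius" for w
    using padic_exp_sums[OF that] by (simp add: S_def[abs_def] sums_def)
  have xy: "vabs (x + y) < radius"
    using vabs_add[of x y] x y by simp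
  have term_le: "vabs (x ^ i / fact i * (y ^ j / fact j)) \<le> vabs (z ^ (i + j) / fact (i + j))" for i j
  proof -
    have "(fact (i + j) :: 'a) = of_nat ((i + j) choose i) * fact i * fact j"
    proof -
      have "fact (i + j) = ((i + j) choose i) * fact i * fact j"
        using binomial_fact_lemma[of i "i + j"] by (simp add: ac_simps)
      from arg_cong[OF this, of "of_nat :: nat \<Rightarrow> 'a"] show ?thesis by simp
    qed
    then have "x ^ i / fact i * (y ^ j / fact j) = of_nat ((i + j) choose i) * (x ^ i * y ^ j) / fact (i + j)"
      by (simp add: field_simps)
    also have "vabs \<dots> = vabs (of_nat ((i + j) choose i) :: 'a) * (vabs x ^ i * vabs y ^ j) / vabs (fact (i + j) :: 'a)"
      by (simp only: vabs_mult vabs_divide vabs_power)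
    also have "\<dots> \<le> 1 * (vabs z ^ i * vabs z ^ j) / vabs (fact (i + j) :: 'a)"
      using z by (intro divide_right_mono mult_mono power_mono vabs_of_nat_le_1) auto
    also have "\<dots> = vabs (z ^ (i + j) / fact (i + j))"
      by (simp add: vabs_divide vabs_mult vabs_power power_add)
    finally show ?thesis .
  qed
  have S_add: "S (x + y) n = (\<Sum>(i,j)\<in>{(i,j). i + j < n}. x ^ i / fact i * (y ^ j / fact j))" for n
  proof -
    have "(x + y) ^ k / fact k = (\<Sum>i\<le>k. x ^ i / fact i * (y ^ (k - i) / fact (k - i)))" for k
      unfolding binomial_ring sum_divide_distrib
      by (intro sum.cong refl) (simp add: binomial_fact)
    then show ?thesis
      unfolding S_def by (subst sum.triangle_reindex) simp
  qed
  have "(\<lambda>n. S x n * S y n - S (x + y) n) \<longlonglongrightarrow> 0"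
  proof (rule metric_LIMSEQ_I)
    fix e :: real assume e: "e > 0"
    obtain M where M: "\<And>k. k \<ge> M \<Longrightarrow> vabs (z ^ k / fact k) < e / 2"
      using eventually_vabs_less[OF exp_term_tendsto_0[OF z(3)], of "e / 2"] e
      by (auto simp: eventually_sequentially)
    have "vabs (S x n * S y n - S (x + y) n) \<le> e / 2" if "n \<ge> M" for n
    proof -
      let ?T = "{(i,j). i + j < n}"
      have sub: "?T \<subseteq> {..<n} \<times> {..<n}" by auto
      have "S x n * S y n = (\<Sum>(i,j)\<in>{..<n} \<times> {..<n}. x ^ i / fact i * (y ^ j / fact j))"
        by (simp add: S_def sum_product sum.cartesian_product)
      then have "S x n * S y n - S (x + y) n
          = (\<Sum>(i,j)\<in>({..<n} \<times> {..<n}) - ?T. x ^ i / fact i * (y ^ j / fact j))"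
        unfolding S_add using sub by (subst sum_diff) auto
      also have "vabs \<dots> \<le> e / 2"
      proof (rule vabs_sum_le)
        fix u assume "u \<in> ({..<n} \<times> {..<n}) - ?T"
        moreover obtain i j where u: "u = (i, j)" by (cases u)
        ultimately have "i + j \<ge> M" using that by simp
        then show "vabs (case u of (i,j) \<Rightarrow> x ^ i / fact i * (y ^ j / fact j)) \<le> e / 2"
          using term_le[of i j] M[of "i + j"] unfolding u by simp
      qed (use e in simp)
      finally show ?thesis .
    qed
    then have "dist (S x n * S y n - S (x + y) n) 0 < e" if "n \<ge> M" for n
      using e that le_less_trans[of _ "e / 2" e] unfolding dist_vabs by fastforce
    then show "\<exists>M. \<forall>n\<ge>M. dist (S x n * S y n - S (x + y) n) 0 < e"
      by blast
  qed
  moreover have "(\<lambda>n. S x n * S y n - S (x + y) n) \<longlonglongrightarrow> padic_exp x * padic_exp y - padic_exp (x + y)"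
    by (intro tendsto_intros S x y xy)
  ultimately have "0 = padic_exp x * padic_exp y - padic_exp (x + y)"
    by (rule LIMSEQ_unique)
  then show ?thesis by simp
qed

lemma vabs_of_nat_mult_le: "vabs (of_nat k * x) \<le> vabs (x :: 'a)"
  using mult_right_mono[OF vabs_of_nat_le_1 vabs_nonneg] by (simp add: vabs_mult)

text \<open>Every term of degree at least 2 contains \<open>c ^ 2\<close> up to a factor of absolute
  value at most 1. With \<open>c = p ^ N\<close> the error stays null after division by
  \<open>p ^ N\<close>.\<close>

lemma padic_exp_linear_error:
  fixes x c :: 'a
  assumes x: "vabs x < radius" and c: "vabs c \<le> 1"
  shows "vabs (padic_exp (c * x) - 1 - c * x) \<le> vabs c ^ 2 * vabs x"
proof -
  have "vabs (c * x) < radius"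
    using mult_right_mono[OF c vabs_nonneg[of x]] x by (simp add: vabs_mult)
  then have *: "(\<lambda>n. (c * x) ^ n / fact n) sums padic_exp (c * x)"
    by (rule padic_exp_sums)
  have "(\<lambda>n. if n = 0 then 1 else 0 :: 'a) sums 1"
    using sums_single[of 0 "\<lambda>_. 1 :: 'a"] .
  note sums_diff_nonarch[OF * this]
  moreover have "(\<lambda>n. if n = 1 then c * x else 0) sums (c * x)"
    using sums_single[of 1 "\<lambda>_. c * x"] .
  ultimately have "(\<lambda>n. (c * x) ^ n / fact n - (if n = 0 then 1 else 0) - (if n = 1 then c * x else 0))
      sums (padic_exp (c * x) - 1 - c * x)" (is "?f sums _")
    by (rule sums_diff_nonarch)
  then have f: "summable ?f" "suminf ?f = padic_exp (c * x) - 1 - c * x"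
    by (simp_all only: sums_iff)
  have "vabs (?f n) \<le> vabs c ^ 2 * vabs x" for n
  proof (cases "n \<ge> 2")
    case True
    have "vabs (?f n) = vabs c ^ n * vabs (x ^ n / fact n)"
      using True by (simp add: power_mult_distrib vabs_mult vabs_divide vabs_power)
    also have "\<dots> \<le> vabs c ^ 2 * vabs x"
      using True x c by (intro mult_mono power_decreasing vabs_exp_term_le_vabs) auto
    finally show ?thesis .
  next
    case False
    then have "n = 0 \<or> n = 1" by auto
    then show ?thesis by auto
  qed
  from vabs_suminf_le[OF f(1) this] show ?thesis
    by (simp only: f(2))
qed

lemma padic_exp_0: "padic_exp (0 :: 'a) = 1"
  using padic_exp_linear_error[of 0 0] radius_pos by simp

lemma padic_exp_of_nat_mult:
  fixes x :: 'a
  assumes "vabs x < radius"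
  shows "padic_exp (of_nat k * x) = padic_exp x ^ k"
proof (induction k)
  case (Suc k)
  have "padic_exp (x + of_nat k * x) = padic_exp x * padic_exp (of_nat k * x)"
    using assms vabs_of_nat_mult_le[of k x] by (intro padic_exp_add) auto
  then show ?case using Suc by (simp add: algebra_simps)
qed (simp add: padic_exp_0)

lemma padic_exp_minus_1_le:
  fixes x :: 'a
  assumes "vabs x < radius"
  shows "vabs (padic_exp x - 1) \<le> vabs x"
  using padic_exp_linear_error[of x 1] vabs_add[of "padic_exp x - 1 - x" x] assms by simp

section \<open>The logarithm series and differences \<open>x ^ n - 1\<close>\<close>

lemma vabs_log_term_le:
  fixes t :: 'a
  shows "vabs (t ^ Suc k / of_nat (Suc k)) \<le> vabs t * (vabs t / radius) ^ k"
proof -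
  \<comment> \<open>Multiplying by the integer \<open>k!\<close> does not increase the absolute
    value, so the majorant of the exponential series serves here too.\<close>
  have "t ^ Suc k / of_nat (Suc k) = of_nat (fact k) * (t ^ Suc k / fact (Suc k))"
    by (simp add: field_simps del: of_nat_Suc)
  also have "vabs \<dots> \<le> vabs (t ^ Suc k / fact (Suc k))"
    by (rule vabs_of_nat_mult_le)
  also note vabs_exp_term_le
  finally show ?thesis .
qed

lemma vabs_sign [simp]: "vabs ((-1) ^ k * x) = vabs (x :: 'a)"
  by (simp add: vabs_mult vabs_power)

lemma summable_padic_log:
  fixes x :: 'a
  assumes "vabs (x - 1) < radius"
  shows "summable (\<lambda>k. (-1) ^ k * (x - 1) ^ Suc k / of_nat (Suc k))"
  by (rule summable_nonarch, rule vabs_null_comparison[OF geometric_majorant_tendsto_0[OF assms]])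
    (simp only: diff_0_right times_divide_eq_right[symmetric] vabs_sign vabs_log_term_le)

lemma vabs_padic_log_le:
  fixes x :: 'a
  assumes "vabs (x - 1) < radius"
  shows "vabs (padic_log x) \<le> vabs (x - 1)"
  unfolding padic_log_def
proof (rule vabs_suminf_le[OF summable_padic_log[OF assms]])
  fix k
  have "vabs (x - 1) * (vabs (x - 1) / radius) ^ k \<le> vabs (x - 1) * 1"
    using assms radius_pos by (intro mult_left_mono power_le_one) auto
  then show "vabs ((-1) ^ k * (x - 1) ^ Suc k / of_nat (Suc k)) \<le> vabs (x - 1)"
    using vabs_log_term_le[of "x - 1" k]
    unfolding times_divide_eq_right[symmetric] vabs_sign by linarith
qed

text \<open>Absorbing the factor \<open>1 / (k + 1)\<close> in the binomial expansion turns the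
  summands into terms of the logarithm series, up to sign, with integer coefficients.\<close>

lemma power_minus_1_expand:
  fixes x :: 'a
  shows "x ^ n - 1 = of_nat n * (\<Sum>k<n. of_nat ((n - 1) choose k) * ((x - 1) ^ Suc k / of_nat (Suc k)))"
proof (cases n)
  case (Suc m)
  have "x ^ n = (\<Sum>k\<le>n. of_nat (n choose k) * (x - 1) ^ k)"
    using binomial_ring[of "x - 1" 1 n] by simp
  also have "\<dots> = 1 + (\<Sum>k<n. of_nat (n choose Suc k) * (x - 1) ^ Suc k)"
    by (simp only: sum.atMost_shift) simp
  finally have *: "x ^ n - 1 = (\<Sum>k<n. of_nat (n choose Suc k) * (x - 1) ^ Suc k)" by simp
  have "of_nat (n choose Suc k) = (of_nat n * of_nat ((n - 1) choose k) / of_nat (Suc k) :: 'a)" for k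
  proof -
    have "(of_nat (Suc k) * of_nat (n choose Suc k) :: 'a) = of_nat n * of_nat ((n - 1) choose k)"
      using Suc_times_binomial_eq[of m k] Suc by (metis diff_Suc_1 mult.commute of_nat_mult)
    then show ?thesis by (simp add: field_simps del: of_nat_Suc)
  qed
  then show ?thesis
    unfolding * sum_distrib_left by (intro sum.cong) (simp_all del: of_nat_Suc power_Suc)
qed simp

text \<open>In the expansion divided by \<open>n\<close>, the term for \<open>k = 0\<close> is
  \<open>x - 1\<close>, and all others are smaller by at least the factor
  \<open>vabs (x - 1) / radius < 1\<close>. The leading term therefore determines the absolute
  value.\<close>

lemma vabs_power_minus_1:
  fixes x :: 'a
  assumes x: "vabs (x - 1) < radius"
  shows "vabs (x ^ n - 1) = vabs (of_nat n :: 'a) * vabs (x - 1)"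
proof (cases "n = 0 \<or> x = 1")
  case False
  let ?t = "x - 1"
  let ?f = "\<lambda>k. of_nat ((n - 1) choose k) * (?t ^ Suc k / of_nat (Suc k)) :: 'a"
  obtain m where n: "n = Suc m" using False not0_implies_Suc by auto
  have small: "vabs (\<Sum>k<m. ?f (Suc k)) \<le> vabs ?t * (vabs ?t / radius)"
  proof (rule vabs_sum_le)
    fix k
    have "vabs (?f (Suc k)) \<le> vabs ?t * (vabs ?t / radius) ^ Suc k"
      using vabs_of_nat_mult_le vabs_log_term_le order_trans by blast
    also have "\<dots> \<le> vabs ?t * (vabs ?t / radius) ^ 1"
      using x radius_pos by (intro mult_left_mono power_decreasing) auto
    finally show "vabs (?f (Suc k)) \<le> vabs ?t * (vabs ?t / radius)" by simp
  qed (use radius_pos in simp)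
  have "vabs ?t > 0" using False by simp
  then have "vabs ?t * (vabs ?t / radius) < vabs ?t * 1"
    using x radius_pos by (intro mult_strict_left_mono) auto
  with small have "vabs (\<Sum>k<m. ?f (Suc k)) < vabs ?t" by linarith
  then have "vabs (?t + (\<Sum>k<m. ?f (Suc k))) = vabs ?t"
    by (rule vabs_add_eq)
  moreover have "(\<Sum>k<n. ?f k) = ?t + (\<Sum>k<m. ?f (Suc k))"
    unfolding n sum.lessThan_Suc_shift by simp
  ultimately have "vabs (\<Sum>k<n. ?f k) = vabs ?t" by simp
  then show ?thesis by (subst power_minus_1_expand) (simp only: vabs_mult)
qed auto

section \<open>The logarithm as a limit of difference quotients\<close>

lemma of_nat_p_power_tendsto_0: "(\<lambda>N. of_nat (p ^ N) :: 'a) \<longlonglongrightarrow> 0"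
proof (rule vabs_null_comparison)
  show "(\<lambda>N. (1 / real p) ^ N) \<longlonglongrightarrow> 0"
    using p_gt_1 by (intro LIMSEQ_power_zero) simp
qed (simp add: vabs_power vabs_p)

text \<open>The upper entry tends to -1. In the induction, Pascal's rule leaves minus the previous
  coefficient and a multiple of \<open>p ^ N\<close>, which vanishes in the limit.\<close>

lemma binomial_p_power_tendsto: "(\<lambda>N. of_nat ((p ^ N - 1) choose k) :: 'a) \<longlonglongrightarrow> (-1) ^ k"
proof (induction k)
  case (Suc k)
  have "of_nat ((p ^ N - 1) choose Suc k) = (of_nat (p ^ N) * of_nat ((p ^ N - 1) choose k) / of_nat (Suc k)
      - of_nat ((p ^ N - 1) choose k) :: 'a)" for N
  proof -
    obtain m where m: "p ^ N = Suc m" using p_gt_1 by (metis not0_implies_Suc not_one_less_zero power_not_zero)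
    have "(of_nat (Suc k) * of_nat (Suc m choose Suc k) :: 'a) = of_nat (Suc m) * of_nat (m choose k)"
      using Suc_times_binomial_eq[of m k] by (metis mult.commute of_nat_mult)
    then have "(of_nat (Suc m) * of_nat (m choose k) / of_nat (Suc k) :: 'a) = of_nat (Suc m choose Suc k)"
      by (simp add: field_simps del: of_nat_Suc binomial_Suc_Suc)
    then show ?thesis unfolding m by simp
  qed
  moreover have "(\<lambda>N. of_nat (p ^ N) * of_nat ((p ^ N - 1) choose k) / of_nat (Suc k)
      - of_nat ((p ^ N - 1) choose k) :: 'a) \<longlonglongrightarrow> 0 * (-1) ^ k * inverse (of_nat (Suc k)) - (-1) ^ k"
    unfolding divide_inverse by (intro tendsto_intros Suc of_nat_p_power_tendsto_0)
  ultimately show ?case by simp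
qed simp

text \<open>The expansion of \<open>x ^ p ^ N - 1\<close> divided by \<open>p ^ N\<close> is the
  logarithm series with each sign \<open>(-1) ^ k\<close> replaced by a binomial coefficient tending
  to it. A majorant independent of \<open>N\<close> permits the termwise limit.\<close>

lemma padic_log_LIMSEQ:
  fixes x :: 'a
  assumes x: "vabs (x - 1) < radius"
  shows "(\<lambda>N. (x ^ p ^ N - 1) / of_nat (p ^ N)) \<longlonglongrightarrow> padic_log x"
proof -
  define l where "l k = (x - 1) ^ Suc k / of_nat (Suc k)" for k
  define a where "a N k = (-1) ^ k * l k - of_nat ((p ^ N - 1) choose k) * l k" for N k
  have "(\<lambda>k. (-1) ^ k * l k) sums padic_log x"
    using summable_sums[OF summable_padic_log[OF x]] by (simp add: padic_log_def l_def)
  moreover have "(\<lambda>k. of_nat ((p ^ N - 1) choose k) * l k) sums ((x ^ p ^ N - 1) / of_nat (p ^ N))" for N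
  proof -
    have "(x ^ p ^ N - 1) / of_nat (p ^ N) = (\<Sum>k<p ^ N. of_nat ((p ^ N - 1) choose k) * l k)"
      using p_gt_1 unfolding l_def by (subst power_minus_1_expand) simp
    \<comment> \<open>The finite sum becomes an infinite series, to be subtracted termwise from the
      logarithm series.\<close>
    moreover have "of_nat ((p ^ N - 1) choose k) * l k = 0" if "k \<notin> {..<p ^ N}" for k
    proof -
      have "0 < p ^ N" using p_gt_1 by simp
      then have "p ^ N - 1 < k" using that unfolding lessThan_iff by linarith
      then show ?thesis by (simp add: binomial_eq_0)
    qed
    ultimately show ?thesis using sums_finite[of "{..<p ^ N}" "\<lambda>k. of_nat ((p ^ N - 1) choose k) * l k"] by simp
  qed
  ultimately have a: "a N sums (padic_log x - (x ^ p ^ N - 1) / of_nat (p ^ N))" for N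
    unfolding a_def by (rule sums_diff_nonarch)
  have "(\<lambda>N. suminf (a N)) \<longlonglongrightarrow> 0"
  proof (rule suminf_nonarch_dominated[OF _ geometric_majorant_tendsto_0[OF x]])
    fix N k
    have "vabs (a N k) \<le> max (vabs (l k)) (vabs (of_nat ((p ^ N - 1) choose k) * l k))"
      unfolding a_def using vabs_diff[of "(-1) ^ k * l k"] by simp
    then show "vabs (a N k) \<le> vabs (x - 1) * (vabs (x - 1) / radius) ^ k"
      using vabs_of_nat_mult_le[of _ "l k"] vabs_log_term_le[of "x - 1" k]
      by (fastforce simp: l_def)
  next
    fix k
    have "(\<lambda>N. a N k) \<longlonglongrightarrow> (-1) ^ k * l k - (-1) ^ k * l k"
      unfolding a_def by (intro tendsto_intros binomial_p_power_tendsto)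
    then show "(\<lambda>N. a N k) \<longlonglongrightarrow> 0" by simp
  qed
  then have "(\<lambda>N. padic_log x - (padic_log x - (x ^ p ^ N - 1) / of_nat (p ^ N))) \<longlonglongrightarrow> padic_log x - 0"
    unfolding sums_unique[OF a, symmetric] by (intro tendsto_intros)
  then show ?thesis by simp
qed

lemma vabs_eq_1:
  fixes x :: 'a
  assumes "vabs (x - 1) < radius"
  shows "vabs x = 1"
  using vabs_add_eq[of "x - 1" 1] assms radius_less_1 by simp

text \<open>The unit \<open>u = exp (log x) / x\<close> satisfies \<open>\<bar>u\<^bsup>p^N\<^esup> - 1\<bar> = \<bar>p\<^sup>N\<bar> \<bar>u - 1\<bar>\<close>, while
  \<open>exp (p\<^sup>N log x)\<close> and \<open>x\<^bsup>p^N\<^esup>\<close> agree to first order in \<open>p\<^sup>N\<close>; hence \<open>u = 1\<close>.\<close>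

lemma padic_exp_log:
  fixes x :: 'a
  assumes x: "vabs (x - 1) < radius"
  shows "padic_exp (padic_log x) = x"
proof -
  define L where "L = padic_log x"
  define u where "u = padic_exp L / x"
  have L: "vabs L < radius"
    unfolding L_def using vabs_padic_log_le[OF x] x by linarith
  have vx: "vabs x = 1" by (rule vabs_eq_1[OF x])
  then have "x \<noteq> 0" by auto
  have "vabs (u - 1) = vabs ((padic_exp L - 1) - (x - 1))"
    using \<open>x \<noteq> 0\<close> vx vabs_divide[of "padic_exp L - x" x] by (simp add: u_def diff_divide_distrib)
  then have u: "vabs (u - 1) < radius"
    using vabs_diff[of "padic_exp L - 1" "x - 1"] padic_exp_minus_1_le[OF L] L x by auto
  have "(\<lambda>N. (padic_exp (of_nat (p ^ N) * L) - 1) / of_nat (p ^ N)) \<longlonglongrightarrow> L"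
  proof (rule vabs_null_comparison)
    show "(\<lambda>N. vabs (of_nat (p ^ N) :: 'a) * vabs L) \<longlonglongrightarrow> 0"
      using tendsto_mult_left_zero[OF of_nat_p_power_tendsto_0[unfolded tendsto_vabs_iff]] by simp
    fix N
    let ?P = "of_nat (p ^ N) :: 'a"
    have P: "?P \<noteq> 0" using p_gt_1 by simp
    have "(padic_exp (?P * L) - 1) / ?P - L = (padic_exp (?P * L) - 1 - ?P * L) / ?P"
      using P by (simp add: field_simps)
    also have "vabs \<dots> \<le> vabs ?P ^ 2 * vabs L / vabs ?P"
      unfolding vabs_divide
      by (intro divide_right_mono padic_exp_linear_error L vabs_of_nat_le_1 vabs_nonneg)
    also have "\<dots> = vabs ?P * vabs L"
      using P by (simp add: power2_eq_square)
    finally show "vabs ((padic_exp (?P * L) - 1) / ?P - L) \<le> vabs ?P * vabs L" .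
  qed
  from tendsto_diff[OF this padic_log_LIMSEQ[OF x]]
  have "(\<lambda>N. (padic_exp (of_nat (p ^ N) * L) - 1) / of_nat (p ^ N) - (x ^ p ^ N - 1) / of_nat (p ^ N)) \<longlonglongrightarrow> 0"
    by (simp add: L_def)
  \<comment> \<open>Factoring out the unit \<open>x ^ p ^ N\<close> shows that this null sequence
    has constant absolute value, which must then be 0.\<close>
  moreover have "vabs ((padic_exp (of_nat (p ^ N) * L) - 1) / of_nat (p ^ N)
      - (x ^ p ^ N - 1) / of_nat (p ^ N)) = vabs (u - 1)" for N
  proof -
    let ?P = "of_nat (p ^ N) :: 'a"
    have P: "?P \<noteq> 0" using p_gt_1 by simp
    have "(padic_exp (?P * L) - 1) / ?P - (x ^ p ^ N - 1) / ?P = x ^ p ^ N * (u ^ p ^ N - 1) / ?P"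
      using \<open>x \<noteq> 0\<close> padic_exp_of_nat_mult[OF L, of "p ^ N"]
      by (simp add: u_def power_divide diff_divide_distrib right_diff_distrib)
    then show ?thesis
      using P by (simp only: vabs_divide vabs_mult vabs_power vx vabs_power_minus_1[OF u]) simp
  qed
  ultimately have "(\<lambda>N::nat. vabs (u - 1)) \<longlonglongrightarrow> 0"
    unfolding tendsto_vabs_iff by simp
  then have "u = 1" by (simp add: LIMSEQ_const_iff)
  then show ?thesis using \<open>x \<noteq> 0\<close> by (simp add: u_def L_def)
qed

section \<open>Powers and brackets at natural arguments\<close>

lemma qpow_of_nat:
  fixes x :: 'a
  assumes "vabs (x - 1) < radius"
  shows "qpow x (of_nat k) = x ^ k"
  unfolding qpow_def padic_exp_of_nat_mult[OF le_less_trans[OF vabs_padic_log_le[OF assms] assms]]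
    padic_exp_log[OF assms] ..

lemma qbracket_of_nat:
  fixes x :: 'a
  assumes "vabs (x - 1) < radius"
  shows "qbracket x (of_nat k) = (\<Sum>i<k. x ^ i)"
  unfolding qbracket_def qpow_of_nat[OF assms] one_diff_power_eq by simp

text \<open>For \<open>x \<noteq> 1\<close> the absolute value of \<open>x ^ k - 1\<close> is a
  product of nonzero factors; for \<open>x = 1\<close> the sum is \<open>k\<close>, nonzero in
  characteristic 0.\<close>

lemma geometric_sum_nonzero:
  fixes x :: 'a
  assumes "vabs (x - 1) < radius" "k > 0"
  shows "(\<Sum>i<k. x ^ i) \<noteq> 0"
proof (cases "x = 1")
  case False
  have "vabs (x ^ k - 1) \<noteq> 0"
    using assms(2) False by (simp add: vabs_power_minus_1[OF assms(1)])
  then have "x ^ k - 1 \<noteq> 0" by simp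
  then show ?thesis using power_diff_1_eq[of x k] by auto
qed (use assms(2) in simp)

lemma vabs_power_minus_1_le:
  fixes x :: 'a
  assumes "vabs (x - 1) < radius"
  shows "vabs (x ^ k - 1) < radius"
  using vabs_power_minus_1[OF assms, of k] vabs_of_nat_mult_le[of k "x - 1"] assms
  by (simp add: vabs_mult)

end

section \<open>The \<open>q\<close>-integrals\<close>

lemma sum_lessThan_add:
  fixes f :: "nat \<Rightarrow> 'b::comm_monoid_add"
  shows "(\<Sum>i<m + n. f i) = (\<Sum>i<m. f i) + (\<Sum>i<n. f (m + i))"
  by (induction n) (simp_all add: add.assoc)

text \<open>\<open>g k = [k]\<close> in base \<open>q\<^bsup>\<alpha>\<^esup>\<close>, \<open>h N = [p\<^sup>N]\<^sub>q\<close> and \<open>A = [\<alpha>]\<^sub>q\<close>, written as geometric sums, which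
  makes the case \<open>q = 1\<close> uniform; \<open>V m n N\<close> is the \<open>N\<close>-th sum approximating the integral at \<open>n\<close>,
  and \<open>R m l\<close> the \<open>l\<close>-th summand on the right-hand side. Its second part is \<open>0\<close> for \<open>m = 0\<close>.\<close>

locale q_integral = padic_valued p T for p :: nat and T :: "'a::nonarch_field itself" +
  fixes q :: 'a and \<alpha> :: nat
  assumes q: "vabs (q - 1) < radius" and \<alpha>: "\<alpha> > 0"
begin

definition g :: "nat \<Rightarrow> 'a"
  where "g k = (\<Sum>i<k. (q ^ \<alpha>) ^ i)"

definition h :: "nat \<Rightarrow> 'a"
  where "h N = (\<Sum>i<p ^ N. q ^ i)"

definition A :: 'a
  where "A = (\<Sum>i<\<alpha>. q ^ i)"

definition V :: "nat \<Rightarrow> nat \<Rightarrow> nat \<Rightarrow> 'a"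
  where "V m n N = 1 / h N * (\<Sum>y<p ^ N. g (n + y) ^ m * q ^ y)"

definition R :: "nat \<Rightarrow> nat \<Rightarrow> 'a"
  where "R m l = (q - 1) * (q ^ l * g l ^ m)
    + of_nat (m * \<alpha>) / A * (q ^ (\<alpha> * l + l) * g l ^ (m - 1))"

section \<open>The geometric sums and their limits along \<open>p ^ N\<close>\<close>

lemma q_nonzero: "q \<noteq> 0"
  using vabs_eq_1[OF q] by auto

lemma h_nonzero: "h N \<noteq> 0"
  using geometric_sum_nonzero[OF q, of "p ^ N"] p_gt_1 by (simp add: h_def)

lemma A_nonzero: "A \<noteq> 0"
  using geometric_sum_nonzero[OF q \<alpha>] by (simp add: A_def)

lemma q_minus_1_h: "(q - 1) * h N = q ^ p ^ N - 1"
  unfolding h_def by (rule power_diff_1_eq[symmetric])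

lemma g_add: "g (l + k) = g l + q ^ (\<alpha> * l) * g k"
  by (simp add: g_def sum_lessThan_add power_add power_mult sum_distrib_left)

text \<open>Both sides equal \<open>[\<alpha> p\<^sup>N]\<^sub>q\<close>.\<close>

lemma g_p_power: "g (p ^ N) * A = h N * (\<Sum>j<\<alpha>. (q ^ p ^ N) ^ j)"
proof (cases "q = 1")
  case False
  \<comment> \<open>Applied twice, with \<open>\<alpha>\<close> and \<open>p ^ N\<close> in either
    order.\<close>
  have *: "(\<Sum>i<a. (x ^ b) ^ i) * (\<Sum>i<b. x ^ i) * (x - 1) = (x ^ b) ^ a - 1" for a b and x :: 'a
    using power_diff_1_eq[of "x ^ b" a] power_diff_1_eq[of x b]
    by (simp add: mult.commute mult.left_commute)
  have "(q ^ \<alpha>) ^ p ^ N = (q ^ p ^ N) ^ \<alpha>"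
    by (simp add: mult.commute flip: power_mult)
  then have "g (p ^ N) * A * (q - 1) = (\<Sum>j<\<alpha>. (q ^ p ^ N) ^ j) * h N * (q - 1)"
    unfolding g_def A_def h_def * by simp
  then show ?thesis using False by simp
next
  case True
  show ?thesis unfolding g_def A_def h_def by (simp add: True)
qed

lemma q_p_power_tendsto: "(\<lambda>N. q ^ p ^ N) \<longlonglongrightarrow> 1"
proof -
  have "(\<lambda>N. vabs (of_nat (p ^ N) :: 'a) * vabs (q - 1)) \<longlonglongrightarrow> 0"
    using tendsto_mult_left_zero[OF of_nat_p_power_tendsto_0[unfolded tendsto_vabs_iff]] by simp
  then show ?thesis
    unfolding tendsto_vabs_iff[of "\<lambda>N. q ^ p ^ N"] vabs_power_minus_1[OF q] .
qed

lemma h_tendsto_0: "h \<longlonglongrightarrow> 0"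
proof (cases "q = 1")
  case True
  then have "h N = of_nat (p ^ N)" for N unfolding h_def by simp
  then show ?thesis using of_nat_p_power_tendsto_0 by (simp only: LIMSEQ_def)
next
  case False
  have "(\<lambda>N. (q ^ p ^ N - 1) * inverse (q - 1)) \<longlonglongrightarrow> (1 - 1) * inverse (q - 1)"
    by (intro tendsto_intros q_p_power_tendsto)
  moreover have "h = (\<lambda>N. (q ^ p ^ N - 1) * inverse (q - 1))"
    using False q_minus_1_h by (auto simp: field_simps)
  ultimately show ?thesis by simp
qed

text \<open>By \<open>g_p_power\<close> the quotient is \<open>1 / A\<close> times a sum of
  \<open>\<alpha>\<close> powers of \<open>q ^ p ^ N\<close>, each tending to 1. This is the source
  of the factor \<open>\<alpha> / A\<close> in \<open>R\<close>.\<close>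

lemma g_quotient_tendsto: "(\<lambda>N. g (p ^ N) / h N) \<longlonglongrightarrow> of_nat \<alpha> / A"
proof -
  have "g (p ^ N) / h N = (\<Sum>j<\<alpha>. (q ^ p ^ N) ^ j) * inverse A" for N
    using g_p_power[of N] h_nonzero[of N] A_nonzero by (simp add: field_simps)
  moreover have "(\<lambda>N. (\<Sum>j<\<alpha>. (q ^ p ^ N) ^ j) * inverse A) \<longlonglongrightarrow> (\<Sum>j<\<alpha>. 1 ^ j) * inverse A"
    by (intro tendsto_intros q_p_power_tendsto)
  ultimately show ?thesis by (simp add: divide_inverse)
qed

lemma g_p_power_tendsto_0: "(\<lambda>N. g (p ^ N)) \<longlonglongrightarrow> 0"
  using tendsto_mult[OF g_quotient_tendsto h_tendsto_0] h_nonzero by simp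

text \<open>A product rule: the increment of \<open>g ^ m\<close> yields the second part of
  \<open>R\<close>, and that of \<open>q ^ y\<close> the first, because \<open>q ^ p ^ N - 1\<close>
  is exactly \<open>(q - 1) * h N\<close>.\<close>

lemma boundary_quotient_tendsto:
  "(\<lambda>N. (g (l + p ^ N) ^ m * q ^ (l + p ^ N) - g l ^ m * q ^ l) / h N) \<longlonglongrightarrow> R m l"
proof -
  let ?s = "\<lambda>N. \<Sum>i<m. g (l + p ^ N) ^ i * g l ^ (m - Suc i)"
  have eq: "(g (l + p ^ N) ^ m * q ^ (l + p ^ N) - g l ^ m * q ^ l) / h N
      = q ^ l * (q ^ p ^ N * (q ^ (\<alpha> * l) * (g (p ^ N) / h N) * ?s N) + g l ^ m * (q - 1))" for N
  proof -
    have "g (l + p ^ N) ^ m - g l ^ m = q ^ (\<alpha> * l) * g (p ^ N) * ?s N"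
    \<comment> \<open>The factorization of a difference of powers is applied with exponent
      \<open>Suc k\<close>; for \<open>m = 0\<close> both sides are 0.\<close>
    proof (cases m)
      case (Suc k)
      then show ?thesis
        using diff_power_eq_sum[of "g (l + p ^ N)" k "g l"]
        by (simp add: g_add del: sum.lessThan_Suc power_Suc)
    qed simp
    then have "g (l + p ^ N) ^ m * q ^ (l + p ^ N) - g l ^ m * q ^ l
        = q ^ l * (q ^ p ^ N * (q ^ (\<alpha> * l) * g (p ^ N) * ?s N) + g l ^ m * ((q - 1) * h N))"
      unfolding q_minus_1_h by (simp add: power_add algebra_simps)
    then show ?thesis using h_nonzero[of N] by (simp add: field_simps)
  qed
  have "(\<lambda>N. g l + q ^ (\<alpha> * l) * g (p ^ N)) \<longlonglongrightarrow> g l + q ^ (\<alpha> * l) * 0"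
    by (intro tendsto_intros g_p_power_tendsto_0)
  then have g: "(\<lambda>N. g (l + p ^ N)) \<longlonglongrightarrow> g l"
    by (simp add: g_add)
  have "?s \<longlonglongrightarrow> (\<Sum>i<m. g l ^ i * g l ^ (m - Suc i))"
    by (intro tendsto_intros g)
  also have "(\<Sum>i<m. g l ^ i * g l ^ (m - Suc i)) = of_nat m * g l ^ (m - 1)"
    by (simp flip: power_add)
  finally have s: "?s \<longlonglongrightarrow> of_nat m * g l ^ (m - 1)" .
  have "(\<lambda>N. q ^ l * (q ^ p ^ N * (q ^ (\<alpha> * l) * (g (p ^ N) / h N) * ?s N) + g l ^ m * (q - 1)))
      \<longlonglongrightarrow> q ^ l * (1 * (q ^ (\<alpha> * l) * (of_nat \<alpha> / A) * (of_nat m * g l ^ (m - 1))) + g l ^ m * (q - 1))"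
    by (intro tendsto_intros q_p_power_tendsto g_quotient_tendsto s)
  then show ?thesis
    unfolding eq R_def by (simp add: power_add algebra_simps)
qed

section \<open>Shifted sums and the existence of the integrals\<close>

lemma V_shift:
  "q ^ n * V m n N = V m 0 N
    + (\<Sum>l<n. (g (l + p ^ N) ^ m * q ^ (l + p ^ N) - g l ^ m * q ^ l) / h N)"
proof -
  let ?f = "\<lambda>y. g y ^ m * q ^ y"
  have "q ^ n * (\<Sum>y<p ^ N. g (n + y) ^ m * q ^ y) = (\<Sum>y<p ^ N. ?f (n + y))"
    by (simp add: sum_distrib_left power_add ac_simps)
  \<comment> \<open>The sum over the first \<open>n + p ^ N\<close> indices is split once after
    \<open>n\<close> terms and once after \<open>p ^ N\<close> terms.\<close>
  also have "\<dots> = (\<Sum>y<p ^ N. ?f y) + (\<Sum>l<n. ?f (l + p ^ N) - ?f l)"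
    using sum_lessThan_add[of ?f n "p ^ N"] sum_lessThan_add[of ?f "p ^ N" n]
    by (simp add: sum_subtractf add.commute algebra_simps)
  finally have "q ^ n * (\<Sum>y<p ^ N. g (n + y) ^ m * q ^ y)
      = (\<Sum>y<p ^ N. ?f y) + (\<Sum>l<n. ?f (l + p ^ N) - ?f l)" .
  from arg_cong[OF this, of "\<lambda>z. z / h N"] show ?thesis
    by (simp add: V_def add_divide_distrib flip: sum_divide_distrib)
qed

text \<open>Expanding \<open>g (y + 1) = 1 + q\<^bsup>\<alpha>\<^esup> g y\<close> in the shift by one yields a recursion for the moments.
  Its leading coefficient vanishes only for \<open>q = 1\<close>, where the next instance determines \<open>V m 0\<close>.\<close>

lemma V_recursion:
  "(\<Sum>j<m. of_nat (m choose j) * q ^ (\<alpha> * j + 1) * V j 0 N) + (q ^ (\<alpha> * m + 1) - 1) * V m 0 N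
    = (g (0 + p ^ N) ^ m * q ^ (0 + p ^ N) - g 0 ^ m * q ^ 0) / h N"
proof -
  have "g (1 + y) ^ m = (\<Sum>j\<le>m. of_nat (m choose j) * q ^ (\<alpha> * j) * g y ^ j)" for y
    using binomial_ring[of "q ^ \<alpha> * g y" 1 m] g_add[of 1 y]
    by (simp add: g_def[of "Suc 0"] power_mult_distrib power_mult add.commute mult.assoc)
  then have "V m 1 N = 1 / h N * (\<Sum>y<p ^ N. \<Sum>j\<le>m. of_nat (m choose j) * q ^ (\<alpha> * j) * (g y ^ j * q ^ y))"
    by (simp add: V_def sum_distrib_right mult.assoc)
  also have "\<dots> = (\<Sum>j\<le>m. of_nat (m choose j) * q ^ (\<alpha> * j) * V j 0 N)"
    by (subst sum.swap) (simp add: V_def sum_distrib_left ac_simps)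
  finally have "q * V m 1 N = (\<Sum>j\<le>m. of_nat (m choose j) * q ^ (\<alpha> * j + 1) * V j 0 N)"
    by (simp add: sum_distrib_left ac_simps)
  \<comment> \<open>Separating the term \<open>j = m\<close> lets it combine with the
    \<open>V m 0 N\<close> from \<open>V_shift\<close> into the coefficient
    \<open>q ^ (\<alpha> * m + 1) - 1\<close>.\<close>
  moreover have "{..m} = insert m {..<m}" by auto
  ultimately show ?thesis
    using V_shift[of 1 m N] by (simp add: algebra_simps)
qed

text \<open>Subtracting the lower moments from the convergent boundary quotient leaves a nonzero
  constant times \<open>V m 0\<close>.\<close>

lemma convergent_V: "convergent (V m 0)"
proof (induction m rule: less_induct)
  case (less m)
  have lower: "convergent (\<lambda>N. \<Sum>j<m. c j * V j 0 N)" for c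
    by (intro convergent_sum convergent_mult convergent_const) (simp add: less.IH)
  have B: "convergent (\<lambda>N. (g (0 + p ^ N) ^ k * q ^ (0 + p ^ N) - g 0 ^ k * q ^ 0) / h N)" for k
    using boundary_quotient_tendsto[of 0 k] by (rule convergentI)
  show ?case
  proof (cases "q = 1")
    case False
    have "vabs (q ^ (\<alpha> * m + 1) - 1) \<noteq> 0"
      unfolding vabs_power_minus_1[OF q] using False by (simp del: of_nat_Suc of_nat_add)
    then have nz: "q ^ (\<alpha> * m + 1) - 1 \<noteq> 0" by (simp only: vabs_eq_0_iff not_False_eq_True)
    have "convergent (\<lambda>N. (q ^ (\<alpha> * m + 1) - 1) * V m 0 N)"
      using convergent_diff[OF B[of m] lower[of "\<lambda>j. of_nat (m choose j) * q ^ (\<alpha> * j + 1)"]]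
      unfolding V_recursion[symmetric] by simp
    then show ?thesis using nz by (subst (asm) convergent_mult_const_iff)
  next
    case True
    \<comment> \<open>In the recursion for \<open>Suc m\<close> the term with
      \<open>V (Suc m) 0\<close> drops out at \<open>q = 1\<close>, and \<open>V m 0\<close> has the
      coefficient \<open>Suc m choose m\<close>, that is \<open>Suc m\<close>.\<close>
    have "convergent (\<lambda>N. of_nat (Suc m) * V m 0 N)"
      using convergent_diff[OF B[of "Suc m"] lower[of "\<lambda>j. of_nat (Suc m choose j)"]]
      unfolding V_recursion[symmetric] by (simp add: True del: binomial_Suc_Suc of_nat_Suc)
    moreover have "(of_nat (Suc m) :: 'a) \<noteq> 0" by (rule of_nat_neq_0)
    ultimately show ?thesis by (subst (asm) convergent_mult_const_iff)
  qed
qed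

lemma V_difference:
  "q ^ n * lim (V m n) - lim (V m 0) = (\<Sum>l<n. R m l)"
proof -
  have "V m 0 \<longlonglongrightarrow> lim (V m 0)"
    using convergent_V by (simp add: convergent_LIMSEQ_iff)
  \<comment> \<open>Solving \<open>V_shift\<close> for \<open>V m n\<close> transfers convergence
    from 0 to \<open>n\<close>, so that \<open>lim (V m n)\<close> is an actual limit.\<close>
  then have "(\<lambda>N. inverse (q ^ n) * (q ^ n * V m n N)) \<longlonglongrightarrow> inverse (q ^ n) * (lim (V m 0) + (\<Sum>l<n. R m l))"
    unfolding V_shift by (intro tendsto_intros boundary_quotient_tendsto)
  then have "V m n \<longlonglongrightarrow> inverse (q ^ n) * (lim (V m 0) + (\<Sum>l<n. R m l))"
    using q_nonzero by (simp add: mult.assoc[symmetric])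
  then have "lim (V m n) = inverse (q ^ n) * (lim (V m 0) + (\<Sum>l<n. R m l))"
    by (rule limI)
  then show ?thesis using q_nonzero by (simp add: mult.assoc[symmetric])
qed

lemma q_bernoulli_poly_eq_lim: "q_bernoulli_poly p \<alpha> m q (of_nat n) = lim (V m n)"
proof -
  have "qbracket (q ^ \<alpha>) (of_nat n + of_nat y) = g (n + y)" for y
    using qbracket_of_nat[OF vabs_power_minus_1_le[OF q], of \<alpha> "n + y"] by (simp add: g_def)
  moreover have "qbracket q (of_nat (p ^ N)) = h N" for N
    using qbracket_of_nat[OF q, of "p ^ N"] by (simp only: h_def)
  ultimately show ?thesis
    by (simp add: q_bernoulli_poly_def volkenborn_q_def V_def[abs_def])
qed

end

theorem theorem5:
  fixes q :: "'a::nonarch_field" and p m \<alpha> n :: nat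
  assumes "prime p" and "odd p"
    and "is_Cp p TYPE('a)"
    and "vabs (1 - q) < real p powr (- 1 / (real p - 1))"
    and "\<alpha> \<ge> 1" and "n \<ge> 1"
  shows "q ^ n * q_bernoulli_poly p \<alpha> m q (of_nat n) - q_bernoulli_number p \<alpha> m q =
    (q - 1) * (\<Sum>l<n. q ^ l * qbracket (q ^ \<alpha>) (of_nat l) ^ m) +
    (if m = 0 then 0
     else of_nat (m * \<alpha>) / qbracket q (of_nat \<alpha>) *
       (\<Sum>l<n. q ^ (\<alpha> * l + l) * qbracket (q ^ \<alpha>) (of_nat l) ^ (m - 1)))"
proof -
  interpret padic_valued p "TYPE('a)"
    using assms by unfold_locales (auto simp: is_Cp_def)
  interpret q_integral p "TYPE('a)" q \<alpha>
    using assms by unfold_locales (auto simp: radius_def vabs_minus_commute[of q])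
  have "qbracket (q ^ \<alpha>) (of_nat l) = g l" for l
    using qbracket_of_nat[OF vabs_power_minus_1_le[OF q]] by (simp add: g_def)
  moreover have "qbracket q (of_nat \<alpha>) = A"
    by (simp add: qbracket_of_nat[OF q] A_def)
  moreover have "q_bernoulli_number p \<alpha> m q = lim (V m 0)"
    using q_bernoulli_poly_eq_lim[of m 0] by (simp add: q_bernoulli_number_def)
  ultimately show ?thesis
    using V_difference[of n m]
    by (simp add: q_bernoulli_poly_eq_lim R_def sum.distrib sum_distrib_left)
qed

end
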